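(* Let $p>2$ be a prime, let $\mathbb{K}$ be a cyclic number field of degree $p$ (that is, $\mathbb{K}/\mathbb{Q}$ is Galois with cyclic Galois group of order $p$), with ring of integers $\mathcal{O}_{\mathbb{K}}$, let $\theta$ be a generator of $\mathrm{Gal}(\mathbb{K}/\mathbb{Q})$, and let $\sigma:\mathbb{K}\to\mathbb{R}^p$ be the canonical embedding. Let $\alpha\in\mathcal{O}_{\mathbb{K}}\setminus\mathbb{Z}$. Then $Tr_{\mathbb{K}}(\alpha)\neq 0$ if and only if the set $\{\sigma(\alpha),\sigma(\theta(\alpha)),\ldots,\sigma(\theta^{p-1}(\alpha))\}$ is an $\mathbb{R}$-linearly independent subset of $\mathbb{R}^p$.
   Context: The field $\mathbb{K}$ is totally real and is regarded as a subfield of $\mathbb{R}$. $Tr_{\mathbb{K}}(\alpha)=\sum_{i=0}^{p-1}\theta^i(\alpha)$ is the trace from $\mathbb{K}$ to $\mathbb{Q}$. The canonical embedding is $\sigma(x)=(x,\theta(x),\theta^2(x),\ldots,\theta^{p-1}(x))$ for $x\in\mathbb{K}$. *)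

theory Defs
  imports
    "Jordan_Normal_Form.VS_Connect"
    "HOL-Algebra.Embedded_Algebras"
    "HOL-Algebra.QuotRing"
    "HOL-Algebra.Elementary_Groups"
    "HOL-Algebra.Bij"
    "HOL-Computational_Algebra.Polynomial"
    "HOL-Computational_Algebra.Primes"
begin

text \<open>
  Number fields are taken inside the real numbers, as sets \<open>K\<close> of reals. A real number field that
  is Galois over \<open>\<rat>\<close> is totally real, since all its embeddings have image \<open>K\<close>; and every totally
  real field is isomorphic to such a set.
\<close>

abbreviation real_field :: "real ring" where
  "real_field \<equiv> class_ring"

definition number_field_of_degree :: "nat \<Rightarrow> real set \<Rightarrow> bool" where
  "number_field_of_degree n K \<longleftrightarrow>
     subfield K real_field \<and> ring.dimension real_field n \<rat> K"

text \<open>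
  As for \<^const>\<open>BijGroup\<close>, automorphisms are extensional (\<open>undefined\<close> outside \<open>K\<close>), so
  that each automorphism of \<open>K\<close> is represented by exactly one function on the reals.
\<close>

definition Gal :: "real set \<Rightarrow> real set \<Rightarrow> (real \<Rightarrow> real) monoid" where
  "Gal K F = BijGroup K
     \<lparr>carrier := {f \<in> Bij K.
        f \<in> Ring.ring_hom (real_field\<lparr>carrier := K\<rparr>) (real_field\<lparr>carrier := K\<rparr>) \<and>
        (\<forall>x\<in>F. f x = x)}\<rparr>"

definition galois_over_rat :: "real set \<Rightarrow> bool" where
  "galois_over_rat K \<longleftrightarrow> {x \<in> K. \<forall>f\<in>carrier (Gal K \<rat>). f x = x} = \<rat>"

definition cyclic_number_field :: "nat \<Rightarrow> real set \<Rightarrow> bool" where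
  "cyclic_number_field n K \<longleftrightarrow>
     number_field_of_degree n K \<and> galois_over_rat K \<and>
     cyclic_group (Gal K \<rat>) \<and> Coset.order (Gal K \<rat>) = n"

definition ring_of_integers :: "real set \<Rightarrow> real set" where
  "ring_of_integers K = {x \<in> K. algebraic_int x}"

definition field_trace :: "nat \<Rightarrow> (real \<Rightarrow> real) \<Rightarrow> real \<Rightarrow> real" where
  "field_trace n \<theta> x = (\<Sum>i<n. (\<theta> ^^ i) x)"

definition canonical_embedding :: "nat \<Rightarrow> (real \<Rightarrow> real) \<Rightarrow> real \<Rightarrow> real vec" where
  "canonical_embedding n \<theta> x = vec n (\<lambda>i. (\<theta> ^^ i) x)"

end

theory Submission
  imports Defs "HOL-Computational_Algebra.Polynomial_Factorial"
begin

hide_const (open) up_ring.coeff up_ring.monom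

text \<open>
  Suppose \<open>(\<Sum>i<p. c i * \<theta>\<^sup>i\<^sup>+\<^sup>j \<alpha>) = 0\<close> for all \<open>j\<close> with real \<open>c\<close>, not all zero. This is a linear system with
  coefficients in \<open>K\<close>, so it also has a nonzero solution in \<open>K\<close>. Scaling one entry to \<open>1\<close> and
  taking traces entrywise gives a nonzero rational solution, because the system is stable under
  \<open>\<theta>\<close> and the trace of \<open>1\<close> is \<open>p\<close>. Hence a nonzero integer polynomial of degree less than \<open>p\<close> in
  \<open>\<theta>\<close> kills \<open>\<alpha>\<close>. The annihilator of \<open>\<alpha>\<close> in \<open>\<int>[X]\<close> is generated by a divisor of
  \<open>X\<^sup>p - 1 = (X - 1) \<Phi>\<close>, and \<open>\<Phi> = 1 + X + \<dots> + X\<^sup>p\<^sup>-\<^sup>1\<close> is irreducible by Eisenstein's criterion. So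
  either \<open>X - 1\<close> kills \<open>\<alpha>\<close>, whence \<open>\<alpha>\<close> is rational and thus an integer, or \<open>\<Phi>\<close> does, whence the
  trace vanishes. Conversely, if the trace is \<open>0\<close>, then the \<open>p\<close> vectors sum to \<open>0\<close>; they are pairwise
  distinct because \<open>p\<close> is prime.
\<close>

section \<open>The cyclotomic polynomial of prime index\<close>

text \<open>At the least \<open>k\<close> with \<open>q\<close> not dividing
  \<open>coeff A k\<close>, the coefficient of \<open>A * B\<close> is congruent to
  \<open>coeff A k * coeff B 0\<close> modulo \<open>q\<close>, so \<open>q\<close> does not divide
  it. A nonconstant \<open>B\<close> would put \<open>k\<close> below the degree of the product,
  against \<open>low\<close>.\<close>

lemma eisenstein_degree_eq_0:
  fixes A B :: "'a :: idom poly"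
  assumes q: "prime_elem q"
    and low: "\<And>k. k < degree (A * B) \<Longrightarrow> q dvd coeff (A * B) k"
    and lead: "\<not> q dvd lead_coeff (A * B)"
    and A0: "q dvd coeff A 0" and B0: "\<not> q dvd coeff B 0"
  shows "degree B = 0"
proof (rule ccontr)
  assume "degree B \<noteq> 0"
  have nz: "A \<noteq> 0" "B \<noteq> 0"
    using lead by auto
  define k where "k = (LEAST k. \<not> q dvd coeff A k)"
  have A_lead: "\<not> q dvd lead_coeff A"
    using lead by (auto simp: lead_coeff_mult)
  have k: "\<not> q dvd coeff A k"
    unfolding k_def by (rule LeastI [of _ "degree A"]) (rule A_lead)
  have k_min: "q dvd coeff A i" if "i < k" for i
    using not_less_Least that unfolding k_def by blast
  have "k \<le> degree A"
    unfolding k_def by (rule Least_le) (rule A_lead)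
  also have "degree A < degree (A * B)"
    using nz \<open>degree B \<noteq> 0\<close> by (simp add: degree_mult_eq)
  finally have "q dvd coeff (A * B) k"
    by (rule low)
  also have "coeff (A * B) k = coeff A k * coeff B 0 + (\<Sum>i<k. coeff A i * coeff B (k - i))"
    by (simp add: coeff_mult lessThan_Suc_atMost [symmetric] add.commute)
  finally have "q dvd coeff A k * coeff B 0"
    using k_min by (subst (asm) dvd_add_left_iff) (auto intro!: dvd_sum)
  then show False
    using k B0 prime_elem_dvd_multD [OF q] by blast
qed

text \<open>For a nonconstant product, \<open>q\<close> divides the product of the two constant
  coefficients but \<open>q^2\<close> does not, so it divides exactly one of them. The factor with
  that coefficient takes the role of \<open>A\<close> above, and the other one is constant.\<close>

lemma eisenstein_factor:
  fixes A B :: "'a :: idom poly"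
  assumes q: "prime_elem q"
    and low: "\<And>k. k < degree (A * B) \<Longrightarrow> q dvd coeff (A * B) k"
    and lead: "\<not> q dvd lead_coeff (A * B)"
    and const: "\<not> q\<^sup>2 dvd coeff (A * B) 0"
  shows "degree A = 0 \<or> degree B = 0"
proof (cases "degree (A * B) = 0")
  case True
  have "A \<noteq> 0" "B \<noteq> 0"
    using lead by auto
  then show ?thesis
    using True by (simp add: degree_mult_eq)
next
  case False
  then have "q dvd coeff A 0 * coeff B 0"
    using low [of 0] by (simp add: coeff_mult)
  then consider "q dvd coeff A 0" | "q dvd coeff B 0"
    using prime_elem_dvd_multD [OF q] by blast
  then show ?thesis
  proof cases
    case 1
    then have "\<not> q dvd coeff B 0"
      using const by (auto simp: coeff_mult power2_eq_square dest: mult_dvd_mono)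
    then show ?thesis
      by (intro disjI2, intro eisenstein_degree_eq_0 [of q A B]) (use q low lead 1 in auto)
  next
    case 2
    then have "\<not> q dvd coeff A 0"
      using const by (auto simp: coeff_mult power2_eq_square dest: mult_dvd_mono)
    then show ?thesis
      by (intro disjI1, intro eisenstein_degree_eq_0 [of q B A]) (use q low lead 2 in \<open>auto simp: mult.commute\<close>)
  qed
qed

section \<open>Irreducibility of 1 + X + ... + X^(p-1)\<close>

definition prime_cyclotomic :: "nat \<Rightarrow> int poly" where
  "prime_cyclotomic p = (\<Sum>i<p. monom 1 i)"

lemma prime_cyclotomic_mult: "[:-1, 1:] * prime_cyclotomic p = monom 1 p - 1"
proof -
  have "monom 1 p - 1 = ([:0, 1:] - 1) * (\<Sum>i<p. [:0, 1:] ^ i :: int poly)"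
    using power_diff_1_eq [of "[:0, 1:] :: int poly" p] by (simp add: monom_altdef)
  also have "[:0, 1:] - 1 = ([:-1, 1:] :: int poly)"
    by (simp add: one_pCons)
  finally show ?thesis
    by (simp add: prime_cyclotomic_def monom_altdef)
qed

lemma coeff_prime_cyclotomic: "coeff (prime_cyclotomic p) k = (if k < p then 1 else 0)"
  by (simp add: prime_cyclotomic_def coeff_sum sum.delta)

lemma degree_prime_cyclotomic: "degree (prime_cyclotomic p) = p - 1"
proof (cases p)
  case (Suc n)
  show ?thesis
  proof (rule antisym)
    show "degree (prime_cyclotomic p) \<le> p - 1"
      using Suc by (auto intro!: degree_le simp: coeff_prime_cyclotomic)
    show "p - 1 \<le> degree (prime_cyclotomic p)"
      using Suc by (intro le_degree) (simp add: coeff_prime_cyclotomic)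
  qed
qed (simp add: prime_cyclotomic_def)

text \<open>Replacing X by X + 1 in (X - 1) \<Phi> = X^p - 1 gives X \<Phi>(X + 1) = (X + 1)^p - 1;
  the factor X accounts for the index shift. Both sides vanish for \<open>k >= p\<close>.\<close>

lemma coeff_prime_cyclotomic_shift:
  "coeff (prime_cyclotomic p \<circ>\<^sub>p [:1, 1:]) k = int (p choose Suc k)"
proof -
  have "pCons 0 (prime_cyclotomic p \<circ>\<^sub>p [:1, 1:]) = ([:-1, 1:] * prime_cyclotomic p) \<circ>\<^sub>p [:1, 1:]"
    by (simp add: pcompose_mult pcompose_pCons del: mult_pCons_left) simp
  \<comment> \<open>X^p is written as a product of p copies of X, so that
    \<open>pcompose_prod\<close> moves the substitution inside the power.\<close>
  also have "\<dots> = [:1, 1:] ^ p - 1"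
    using pcompose_prod [of "\<lambda>_. [:0, 1:]" "{..<p}" "[:1, 1:] :: int poly"]
    unfolding prime_cyclotomic_mult by (simp add: pcompose_diff monom_altdef pcompose_pCons pcompose_1)
  finally have "coeff (prime_cyclotomic p \<circ>\<^sub>p [:1, 1:]) k = coeff ([:1, 1:] ^ p - 1) (Suc k)"
    by (metis coeff_pCons_Suc)
  also have "\<dots> = int (p choose Suc k)"
  proof (cases "Suc k \<le> p")
    case True
    then show ?thesis
      by (simp add: coeff_linear_poly_power)
  next
    case False
    have "degree ([:1, 1:] ^ p :: int poly) \<le> p"
      using degree_power_le [of "[:1, 1:] :: int poly" p] by simp
    with False have "coeff ([:1, 1:] ^ p :: int poly) (Suc k) = 0"
      by (intro coeff_eq_0) simp
    with False show ?thesis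
      by simp
  qed
  finally show ?thesis .
qed

text \<open>Eisenstein applies at p to \<Phi>(X + 1), whose coefficients are the binomials (p choose
  k + 1): constant term p, leading term 1. Substituting X + 1 preserves degrees, and irreducible
  elements of the factorial ring \<int>[X] are prime.\<close>

lemma prime_elem_prime_cyclotomic:
  assumes p: "prime (p :: nat)"
  shows "prime_elem (prime_cyclotomic p)"
proof (rule irreducible_imp_prime_poly, rule irreducibleI)
  have "p > 1"
    using p prime_gt_1_nat by simp
  show "prime_cyclotomic p \<noteq> 0"
    using coeff_prime_cyclotomic [of p 0] \<open>p > 1\<close> by auto
  show "\<not> prime_cyclotomic p dvd 1"
    using degree_prime_cyclotomic [of p] \<open>p > 1\<close> by (auto simp: is_unit_poly_iff)
  \<comment> \<open>Over \<int> a constant factor need not be a unit; here it divides the constant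
    coefficient 1.\<close>
  have const_unit: "C dvd 1" if "prime_cyclotomic p = C * D" "degree C = 0" for C D
  proof -
    obtain c where "C = [:c:]"
      using \<open>degree C = 0\<close> by (rule degree_eq_zeroE)
    then have "1 = c * coeff D 0"
      using that(1) coeff_prime_cyclotomic [of p 0] \<open>p > 1\<close> by (simp add: coeff_mult)
    then have "c dvd 1"
      by (rule dvdI)
    with \<open>C = [:c:]\<close> show ?thesis
      by (simp add: is_unit_poly_iff)
  qed
  fix A B
  assume AB: "prime_cyclotomic p = A * B"
  let ?s = "\<lambda>f. f \<circ>\<^sub>p [:1, 1 :: int:]"
  have shift: "?s A * ?s B = ?s (prime_cyclotomic p)"
    by (simp add: AB pcompose_mult)
  have deg: "degree (?s A * ?s B) = p - 1"
    unfolding shift by (simp add: degree_pcompose degree_prime_cyclotomic)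
  have "degree (?s A) = 0 \<or> degree (?s B) = 0"
  proof (rule eisenstein_factor)
    show "prime_elem (int p)"
      using p by simp
    show "int p dvd coeff (?s A * ?s B) k" if "k < degree (?s A * ?s B)" for k
      using that p unfolding deg unfolding shift coeff_prime_cyclotomic_shift
      by (auto intro!: dvd_choose_prime)
    show "\<not> int p dvd lead_coeff (?s A * ?s B)"
      using p \<open>p > 1\<close> unfolding deg unfolding shift coeff_prime_cyclotomic_shift by simp
    show "\<not> (int p)\<^sup>2 dvd coeff (?s A * ?s B) 0"
      using \<open>p > 1\<close> unfolding shift coeff_prime_cyclotomic_shift
      by (auto simp: power2_eq_square zdvd_not_zless)
  qed
  then have "degree A = 0 \<or> degree B = 0"
    by (simp add: degree_pcompose)
  then show "A dvd 1 \<or> B dvd 1"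
    using const_unit [OF AB] const_unit [of B A] AB by (auto simp: mult.commute)
qed

section \<open>Ideals of integer polynomials\<close>

text \<open>\<int>[X] is not a principal ideal domain, but saturation lets the generator be found
  over \<rat>: take a nonzero element of least degree and pass to its primitive part.\<close>

lemma saturated_ideal_generator:
  fixes I :: "int poly set"
  assumes diff: "\<And>f g. f \<in> I \<Longrightarrow> g \<in> I \<Longrightarrow> f - g \<in> I"
    and mult: "\<And>f g. g \<in> I \<Longrightarrow> f * g \<in> I"
    and sat: "\<And>c f. c \<noteq> 0 \<Longrightarrow> Polynomial.smult c f \<in> I \<Longrightarrow> f \<in> I"
    and g: "g \<in> I" "g \<noteq> 0"
  shows "\<exists>m\<in>I. \<forall>f\<in>I. m dvd f"
proof -
  obtain h where h: "h \<in> I" "h \<noteq> 0" and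
    h_min: "\<And>f. f \<in> I \<Longrightarrow> f \<noteq> 0 \<Longrightarrow> degree h \<le> degree f"
    using ex_has_least_nat [of "\<lambda>f. f \<in> I \<and> f \<noteq> 0" g degree] g by auto
  define m where "m = primitive_part h"
  have m: "m \<in> I" "m \<noteq> 0" "degree m = degree h" "content m = 1"
    using h sat [of "content h" m] by (auto simp: m_def)
  have "m dvd f" if "f \<in> I" for f
  proof -
    \<comment> \<open>Division by \<open>m\<close> is possible only after scaling \<open>f\<close>
      by some nonzero \<open>c\<close>, since the leading coefficient of \<open>m\<close> need not
      be a unit.\<close>
    obtain c q where c: "c \<noteq> 0" "Polynomial.smult c f = m * q + pseudo_mod f m"
      using pseudo_mod(1) [OF m(2), of f] by blast
    have "pseudo_mod f m = [:c:] * f - q * m"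
      using c by (simp add: mult.commute)
    then have "pseudo_mod f m \<in> I"
      using that m(1) by (auto intro!: diff mult simp del: mult_pCons_left)
    then have "pseudo_mod f m = 0"
      using h_min pseudo_mod(2) [OF m(2), of f] m(3) by fastforce
    then have "m dvd Polynomial.smult c f"
      using c by simp
    \<comment> \<open>Over the fraction field \<open>c\<close> is invertible and drops out. Gauss's
      lemma for the primitive \<open>m\<close> then brings divisibility back to \<int>[X].\<close>
    then have "fract_poly m dvd fract_poly (Polynomial.smult c f)"
      by (rule fract_poly_dvd)
    then have "fract_poly m dvd fract_poly f"
      using c(1) by (simp add: dvd_smult_iff)
    then show ?thesis
      using m(4) by (rule fract_poly_dvdD)
  qed
  with m(1) show ?thesis
    by blast
qed

section \<open>Linear systems over a subfield\<close>

text \<open>Gaussian elimination, by induction on the set of unknowns: the pivots and all quotients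
  formed stay in \<open>F\<close>, even though the given solution \<open>c\<close> need not.\<close>

lemma nontrivial_solution_in_subfield:
  fixes F :: "'a :: field set" and a :: "'j \<Rightarrow> 'i \<Rightarrow> 'a"
  assumes one: "1 \<in> F"
    and diff: "\<And>x y. x \<in> F \<Longrightarrow> y \<in> F \<Longrightarrow> x - y \<in> F"
    and mult: "\<And>x y. x \<in> F \<Longrightarrow> y \<in> F \<Longrightarrow> x * y \<in> F"
    and inv: "\<And>x. x \<in> F \<Longrightarrow> inverse x \<in> F"
    and fin: "finite I"
    and a: "\<And>j i. j \<in> J \<Longrightarrow> i \<in> I \<Longrightarrow> a j i \<in> F"
    and sol: "\<And>j. j \<in> J \<Longrightarrow> (\<Sum>i\<in>I. a j i * c i) = 0" "\<exists>i\<in>I. c i \<noteq> 0"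
  shows "\<exists>d. (\<forall>i\<in>I. d i \<in> F) \<and> (\<exists>i\<in>I. d i \<noteq> 0) \<and> (\<forall>j\<in>J. (\<Sum>i\<in>I. a j i * d i) = 0)"
  using fin a sol
proof (induction I arbitrary: a)
  case empty
  then show ?case by simp
next
  case (insert k I)
  have zero: "0 \<in> F"
    using diff [OF one one] by simp
  have sum: "(\<Sum>i\<in>A. f i) \<in> F" if "\<And>i. i \<in> A \<Longrightarrow> f i \<in> F" for A :: "'i set" and f
    using that
  proof (induction A rule: infinite_finite_induct)
    case (insert i A)
    then have "f i - (0 - sum f A) \<in> F"
      by (intro diff zero) auto
    with insert.hyps show ?case by simp
  qed (auto simp: zero)
  show ?case
  proof (cases "\<forall>j\<in>J. a j k = 0")
    case True
    have "(\<Sum>i\<in>insert k I. a j i * (if i = k then 1 else 0)) = 0" if "j \<in> J" for j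
      using True that insert.hyps by (auto intro!: sum.neutral)
    then show ?thesis
      using one zero by (intro exI [of _ "\<lambda>i. if i = k then 1 else 0"]) auto
  next
    case False
    then obtain l where l: "l \<in> J" "a l k \<noteq> 0"
      by blast
    \<comment> \<open>Subtracting multiples of the pivot row \<open>l\<close> clears column
      \<open>k\<close>, so \<open>c\<close> still solves the reduced system in the unknowns
      \<open>I\<close>.\<close>
    define b where "b j i = a j i - a j k / a l k * a l i" for j i
    have eq: "c k * a j k + (\<Sum>i\<in>I. a j i * c i) = 0" if "j \<in> J" for j
      using insert.prems(2) [OF that] insert.hyps by (simp add: mult.commute)
    have b_sum: "(\<Sum>i\<in>I. b j i * x i) =
        (\<Sum>i\<in>I. a j i * x i) - a j k / a l k * (\<Sum>i\<in>I. a l i * x i)" for j x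
      by (simp add: b_def left_diff_distrib sum_subtractf sum_distrib_left mult.assoc)
    have "(\<Sum>i\<in>I. b j i * c i) = 0" if "j \<in> J" for j
    proof -
      have "(\<Sum>i\<in>I. a j i * c i) = - (c k * a j k)" "(\<Sum>i\<in>I. a l i * c i) = - (c k * a l k)"
        using eq [OF that] eq [OF l(1)] by (simp_all add: add_eq_0_iff)
      then show ?thesis
        using l(2) unfolding b_sum by simp
    qed
    moreover have "b j i \<in> F" if "j \<in> J" "i \<in> I" for j i
      unfolding b_def divide_inverse
      using that l(1) by (intro diff mult inv insert.prems) auto
    \<comment> \<open>If \<open>c\<close> vanished on \<open>I\<close>, the pivot equation would
      force \<open>c k = 0\<close> as well.\<close>
    moreover have "\<exists>i\<in>I. c i \<noteq> 0"
    proof (rule ccontr)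
      assume "\<not> (\<exists>i\<in>I. c i \<noteq> 0)"
      then have "(\<Sum>i\<in>I. a l i * c i) = 0" "c k \<noteq> 0"
        using insert.prems(3) by auto
      then show False
        using eq [OF l(1)] l(2) by simp
    qed
    ultimately obtain d where d: "\<forall>i\<in>I. d i \<in> F" "\<exists>i\<in>I. d i \<noteq> 0"
      "\<forall>j\<in>J. (\<Sum>i\<in>I. b j i * d i) = 0"
      using insert.IH [of b] by blast
    define s where "s = (\<Sum>i\<in>I. a l i * d i)"
    \<comment> \<open>Back substitution: the value at \<open>k\<close> solves the pivot equation.
      Negation is written \<open>0 - s\<close> because closure is given for differences.\<close>
    define e where "e = d(k := (0 - s) * inverse (a l k))"
    have e_I: "(\<Sum>i\<in>I. a j i * e i) = (\<Sum>i\<in>I. a j i * d i)" for j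
      using insert.hyps by (intro sum.cong) (auto simp: e_def)
    have "(0 - s) * inverse (a l k) \<in> F"
      unfolding s_def using d(1) l(1) by (intro mult diff zero inv sum insert.prems) auto
    then have "\<forall>i\<in>insert k I. e i \<in> F"
      using d(1) by (simp add: e_def)
    moreover have "\<exists>i\<in>insert k I. e i \<noteq> 0"
      using d(2) insert.hyps unfolding e_def by auto
    moreover have "(\<Sum>i\<in>insert k I. a j i * e i) = 0" if "j \<in> J" for j
    proof -
      have "(\<Sum>i\<in>insert k I. a j i * e i) = a j k * e k + (\<Sum>i\<in>I. a j i * d i)"
        using insert.hyps by (simp add: e_I)
      also have "\<dots> = (\<Sum>i\<in>I. b j i * d i)"
        unfolding b_sum s_def [symmetric] by (simp add: e_def divide_inverse)
      finally show ?thesis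
        using d(3) that by simp
    qed
    ultimately show ?thesis by blast
  qed
qed

lemma Rats_common_denominator:
  fixes q :: "'i \<Rightarrow> 'a :: field_char_0"
  assumes "finite I" "\<And>i. i \<in> I \<Longrightarrow> q i \<in> \<rat>"
  shows "\<exists>N::int. N \<noteq> 0 \<and> (\<forall>i\<in>I. of_int N * q i \<in> \<int>)"
  using assms
proof (induction I)
  case empty
  show ?case by (intro exI [of _ 1]) simp
next
  case (insert k I)
  then obtain N :: int where N: "N \<noteq> 0" "\<forall>i\<in>I. of_int N * q i \<in> \<int>"
    by auto
  obtain a b :: int where ab: "b > 0" "q k = of_int a / of_int b"
    using insert.prems [of k] by (auto elim: Rats_cases')
  have "of_int (N * b) * q i \<in> \<int>" if "i \<in> insert k I" for i
  proof (cases "i = k")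
    case True
    with ab have "of_int (N * b) * q i = of_int (N * a)"
      by simp
    then show ?thesis by (metis Ints_of_int)
  next
    case False
    with that N(2) have "of_int N * q i \<in> \<int>"
      by blast
    then have "of_int b * (of_int N * q i) \<in> \<int>"
      by (rule Ints_mult [OF Ints_of_int])
    also have "of_int b * (of_int N * q i) = of_int (N * b) * q i"
      by (simp add: mult_ac)
    finally show ?thesis .
  qed
  with N(1) ab(1) show ?case
    by (intro exI [of _ "N * b"]) auto
qed

section \<open>Automorphisms of prime order\<close>

text \<open>The Galois data in elementary form: \<open>theta_pow_p\<close> records the order of the
  group, and \<open>theta_fixed\<close> records that the fixed field of \<theta> lies in
  \<rat>.\<close>

locale cyclic_automorphism =
  fixes p :: nat and K :: "real set" and \<theta> :: "real \<Rightarrow> real"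
  assumes prime_p: "prime p"
    and one_closed: "1 \<in> K"
    and diff_closed: "x \<in> K \<Longrightarrow> y \<in> K \<Longrightarrow> x - y \<in> K"
    and mult_closed: "x \<in> K \<Longrightarrow> y \<in> K \<Longrightarrow> x * y \<in> K"
    and inverse_closed: "x \<in> K \<Longrightarrow> inverse x \<in> K"
    and theta_closed: "x \<in> K \<Longrightarrow> \<theta> x \<in> K"
    and theta_add: "x \<in> K \<Longrightarrow> y \<in> K \<Longrightarrow> \<theta> (x + y) = \<theta> x + \<theta> y"
    and theta_mult: "x \<in> K \<Longrightarrow> y \<in> K \<Longrightarrow> \<theta> (x * y) = \<theta> x * \<theta> y"
    and theta_one: "\<theta> 1 = 1"
    and theta_pow_p: "x \<in> K \<Longrightarrow> (\<theta> ^^ p) x = x"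
    and theta_fixed: "x \<in> K \<Longrightarrow> \<theta> x = x \<Longrightarrow> x \<in> \<rat>"
begin

section \<open>Arithmetic in K and iterates of \<theta>\<close>

lemma p_pos: "p > 0"
  using prime_p prime_gt_0_nat by blast

lemma zero_closed: "0 \<in> K"
  using diff_closed [OF one_closed one_closed] by simp

lemma add_closed: "x \<in> K \<Longrightarrow> y \<in> K \<Longrightarrow> x + y \<in> K"
  using diff_closed [of x "0 - y"] diff_closed [OF zero_closed, of y] by simp

lemma sum_closed: "(\<And>i. i \<in> A \<Longrightarrow> f i \<in> K) \<Longrightarrow> (\<Sum>i\<in>A. f i) \<in> K"
  by (induction A rule: infinite_finite_induct) (auto intro: add_closed zero_closed)

lemma of_nat_closed: "of_nat n \<in> K"
  by (induction n) (auto intro: add_closed zero_closed one_closed)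

lemma of_int_closed: "of_int n \<in> K"
proof (cases n)
  case (nonneg m)
  then show ?thesis using of_nat_closed [of m] by simp
next
  case (neg m)
  have "0 - of_nat (Suc m) \<in> K"
    by (rule diff_closed [OF zero_closed of_nat_closed])
  with neg show ?thesis by simp
qed

lemma theta_zero: "\<theta> 0 = 0"
  using theta_add [OF zero_closed zero_closed] by simp

lemma theta_of_nat: "\<theta> (of_nat n) = of_nat n"
  by (induction n) (auto simp: theta_zero theta_one theta_add of_nat_closed one_closed)

lemma theta_of_int: "\<theta> (of_int n) = of_int n"
proof (cases n)
  case (nonneg m)
  then show ?thesis using theta_of_nat [of m] by simp
next
  case (neg m)
  have "\<theta> (of_int n) + \<theta> (of_nat (Suc m)) = \<theta> (of_int n + of_nat (Suc m))"
    by (rule theta_add [symmetric]) (rule of_int_closed of_nat_closed)+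
  also have "\<dots> = 0"
    using neg theta_zero by simp
  finally show ?thesis
    using neg theta_of_nat [of "Suc m"] by simp
qed

lemma pow_closed: "x \<in> K \<Longrightarrow> (\<theta> ^^ i) x \<in> K"
  by (induction i) (auto intro: theta_closed)

lemma pow_zero: "(\<theta> ^^ i) 0 = 0"
  by (induction i) (auto simp: theta_zero)

lemma pow_one: "(\<theta> ^^ i) 1 = 1"
  by (induction i) (auto simp: theta_one)

lemma pow_add: "x \<in> K \<Longrightarrow> y \<in> K \<Longrightarrow> (\<theta> ^^ i) (x + y) = (\<theta> ^^ i) x + (\<theta> ^^ i) y"
  by (induction i) (auto simp: theta_add pow_closed)

lemma pow_mult: "x \<in> K \<Longrightarrow> y \<in> K \<Longrightarrow> (\<theta> ^^ i) (x * y) = (\<theta> ^^ i) x * (\<theta> ^^ i) y"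
  by (induction i) (auto simp: theta_mult pow_closed)

lemma pow_sum:
  "(\<And>j. j \<in> A \<Longrightarrow> f j \<in> K) \<Longrightarrow> (\<theta> ^^ i) (\<Sum>j\<in>A. f j) = (\<Sum>j\<in>A. (\<theta> ^^ i) (f j))"
  by (induction A rule: infinite_finite_induct) (auto simp: pow_zero pow_add sum_closed)

lemma pow_mod: "x \<in> K \<Longrightarrow> (\<theta> ^^ (i mod p)) x = (\<theta> ^^ i) x"
  by (intro funpow_mod_eq theta_pow_p)

text \<open>Applying \<theta> shifts the summands cyclically, because the p-th iterate returns to
  \<open>x\<close>; so the trace is fixed by \<theta>.\<close>

lemma trace_Rats:
  assumes "x \<in> K"
  shows "field_trace p \<theta> x \<in> \<rat>"
proof (rule theta_fixed)
  show "field_trace p \<theta> x \<in> K"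
    using assms unfolding field_trace_def by (intro sum_closed pow_closed)
  have "\<theta> (field_trace p \<theta> x) = (\<Sum>i<p. (\<theta> ^^ Suc i) x)"
    using assms pow_sum [of "{..<p}" "\<lambda>i. (\<theta> ^^ i) x" 1]
    by (simp add: field_trace_def pow_closed)
  also have "\<dots> = (\<Sum>i<Suc p. (\<theta> ^^ i) x) - x"
    by (subst sum.lessThan_Suc_shift) simp
  also have "\<dots> = field_trace p \<theta> x"
    using assms by (simp add: field_trace_def theta_pow_p)
  finally show "\<theta> (field_trace p \<theta> x) = field_trace p \<theta> x" .
qed

text \<open>The \<open>\<int>[X]\<close>-module structure on \<open>K\<close> in which \<open>X\<close> acts as \<open>\<theta>\<close>.\<close>

definition act :: "int poly \<Rightarrow> real \<Rightarrow> real" where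
  "act f x = fold_coeffs (\<lambda>a g. of_int a * x + \<theta> g) f 0"

lemma act_0: "act 0 x = 0"
  by (simp add: act_def)

lemma act_pCons: "act (pCons a f) x = of_int a * x + \<theta> (act f x)"
  \<comment> \<open>The case \<open>a = 0\<close>, \<open>f = 0\<close> is separate because
    \<open>pCons 0 0\<close> is the zero polynomial, on which \<open>fold_coeffs\<close> performs no
    step.\<close>
  by (cases "a = 0 \<and> f = 0") (auto simp: act_def theta_zero)

lemma act_closed: "x \<in> K \<Longrightarrow> act f x \<in> K"
  by (induction f) (auto simp: act_0 act_pCons intro: zero_closed add_closed mult_closed of_int_closed theta_closed)

lemma act_add: "x \<in> K \<Longrightarrow> act (f + g) x = act f x + act g x"
  by (induction f g rule: poly_induct2)
    (auto simp: act_0 act_pCons theta_add act_closed algebra_simps)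

lemma act_smult: "x \<in> K \<Longrightarrow> act (Polynomial.smult c f) x = of_int c * act f x"
  by (induction f)
    (auto simp: act_0 act_pCons theta_mult theta_of_int of_int_closed act_closed algebra_simps)

lemma act_diff: "x \<in> K \<Longrightarrow> act (f - g) x = act f x - act g x"
  using act_add [of x f "Polynomial.smult (-1) g"] act_smult [of x "-1" g] by simp

lemma act_mult: "x \<in> K \<Longrightarrow> act (f * g) x = act f (act g x)"
  by (induction f) (auto simp: act_0 act_pCons act_add act_smult)

lemma act_monom: "x \<in> K \<Longrightarrow> act (monom c i) x = of_int c * (\<theta> ^^ i) x"
  by (induction i)
    (auto simp: monom_0 monom_Suc act_0 act_pCons theta_zero theta_mult theta_of_int of_int_closed pow_closed)

lemma act_sum: "x \<in> K \<Longrightarrow> act (\<Sum>i\<in>A. f i) x = (\<Sum>i\<in>A. act (f i) x)"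
  by (induction A rule: infinite_finite_induct) (auto simp: act_0 act_add)

lemma act_at_0: "act f 0 = 0"
  by (induction f) (auto simp: act_0 act_pCons theta_zero)

lemma act_prime_cyclotomic: "x \<in> K \<Longrightarrow> act (prime_cyclotomic p) x = field_trace p \<theta> x"
  by (simp add: prime_cyclotomic_def act_sum act_monom field_trace_def)

section \<open>Linear relations among the conjugates of \<alpha>\<close>

lemma trace_eq_0_of_int_relation:
  assumes \<alpha>: "\<alpha> \<in> K" "\<theta> \<alpha> \<noteq> \<alpha>"
    and c: "\<exists>i<p. c i \<noteq> 0" "(\<Sum>i<p. of_int (c i) * (\<theta> ^^ i) \<alpha>) = 0"
  shows "field_trace p \<theta> \<alpha> = 0"
proof -
  define I where "I = {f. act f \<alpha> = 0}"
  define g where "g = (\<Sum>i<p. monom (c i) i)"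
  have coeff_g: "coeff g k = (if k < p then c k else 0)" for k
    by (simp add: g_def coeff_sum)
  have "g \<noteq> 0"
    using c(1) coeff_g by (metis coeff_0)
  have "g \<in> I"
    using \<alpha>(1) c(2) by (simp add: I_def g_def act_sum act_monom)
  have I_mult: "f * h \<in> I" if "h \<in> I" for f h
    using that \<alpha>(1) by (simp add: I_def act_mult act_at_0)
  have I_sat: "f \<in> I" if "k \<noteq> 0" "Polynomial.smult k f \<in> I" for k f
    using that \<alpha>(1) by (simp add: I_def act_smult)
  have "\<exists>m\<in>I. \<forall>f\<in>I. m dvd f"
  proof (rule saturated_ideal_generator)
    show "f - h \<in> I" if "f \<in> I" "h \<in> I" for f h
      using that \<alpha>(1) by (simp add: I_def act_diff)
  qed (fact I_mult I_sat \<open>g \<in> I\<close> \<open>g \<noteq> 0\<close>)+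
  then obtain m where m: "m \<in> I" "\<And>f. f \<in> I \<Longrightarrow> m dvd f"
    by blast
  let ?\<Phi> = "prime_cyclotomic p"
  have prime_\<Phi>: "prime_elem ?\<Phi>"
    by (rule prime_elem_prime_cyclotomic [OF prime_p])
  have "monom 1 p - 1 \<in> I"
    using \<alpha>(1) by (simp add: I_def act_diff act_monom theta_pow_p one_pCons act_pCons act_0 theta_zero)
  then have "m dvd [:-1, 1:] * ?\<Phi>"
    unfolding prime_cyclotomic_mult by (rule m(2))
  then obtain k where k: "[:-1, 1:] * ?\<Phi> = m * k" ..
  then have "?\<Phi> dvd m * k"
    using dvd_triv_right [of ?\<Phi> "[:-1, 1:]"] by metis
  then consider "?\<Phi> dvd m" | "?\<Phi> dvd k"
    using prime_elem_dvd_multD [OF prime_\<Phi>] by blast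
  then show ?thesis
  proof cases
    \<comment> \<open>Here \<Phi> divides \<open>g\<close>, whose degree is at most p - 1, so
      \<open>g\<close> is an integer multiple of \<Phi>. Saturation puts \<Phi> itself into the
      annihilator, and \<Phi> acts as the trace.\<close>
    case 1
    then have "?\<Phi> dvd g"
      using m(2) [OF \<open>g \<in> I\<close>] by (rule dvd_trans)
    then obtain l where l: "g = ?\<Phi> * l" ..
    have "degree g \<le> p - 1"
      by (rule degree_le) (use coeff_g in auto)
    moreover have "degree g = p - 1 + degree l"
      using \<open>g \<noteq> 0\<close> unfolding l by (subst degree_mult_eq) (auto simp: degree_prime_cyclotomic)
    ultimately have "degree l = 0"
      by simp
    then obtain d where "l = [:d:]"
      by (rule degree_eq_zeroE)
    with l have "g = Polynomial.smult d ?\<Phi>"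
      by simp
    with \<open>g \<in> I\<close> \<open>g \<noteq> 0\<close> have "?\<Phi> \<in> I"
      using I_sat [of d ?\<Phi>] by (metis smult_0_left)
    then show ?thesis
      using \<alpha>(1) by (simp add: I_def act_prime_cyclotomic)
  next
    \<comment> \<open>Cancelling \<Phi> shows that \<open>m\<close> divides X - 1, so \<theta> would
      fix \<alpha>, a contradiction.\<close>
    case 2
    then obtain l where "k = ?\<Phi> * l" ..
    with k have "?\<Phi> * [:-1, 1:] = ?\<Phi> * (l * m)"
      by (simp only: mult_ac)
    then have "[:-1, 1:] = l * m"
      using prime_\<Phi> by (subst (asm) mult_left_cancel) auto
    then have "[:-1, 1:] \<in> I"
      using I_mult [OF m(1)] by metis
    then show ?thesis
      using \<alpha> by (simp add: I_def act_pCons act_0 theta_zero)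
  qed
qed

lemma int_relation_of_real_relation:
  fixes c :: "nat \<Rightarrow> real"
  assumes \<alpha>: "\<alpha> \<in> K"
    and c: "\<exists>i<p. c i \<noteq> 0" "\<And>j. j < p \<Longrightarrow> (\<Sum>i<p. c i * (\<theta> ^^ (i + j)) \<alpha>) = 0"
  obtains b :: "nat \<Rightarrow> int" where "\<exists>i<p. b i \<noteq> 0" "(\<Sum>i<p. of_int (b i) * (\<theta> ^^ i) \<alpha>) = 0"
proof -
  have "\<exists>d. (\<forall>i\<in>{..<p}. d i \<in> K) \<and> (\<exists>i\<in>{..<p}. d i \<noteq> 0) \<and>
      (\<forall>j\<in>{..<p}. (\<Sum>i\<in>{..<p}. (\<theta> ^^ (i + j)) \<alpha> * d i) = 0)"
  proof (rule nontrivial_solution_in_subfield)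
    show "(\<Sum>i\<in>{..<p}. (\<theta> ^^ (i + j)) \<alpha> * c i) = 0" if "j \<in> {..<p}" for j
      using c(2) [of j] that by (simp add: mult.commute)
    show "\<exists>i\<in>{..<p}. c i \<noteq> 0"
      using c(1) by auto
  qed (use \<alpha> in \<open>auto intro: one_closed diff_closed mult_closed inverse_closed pow_closed\<close>)
  then obtain d i0 where d: "\<And>i. i < p \<Longrightarrow> d i \<in> K" "i0 < p" "d i0 \<noteq> 0"
    "\<And>j. j < p \<Longrightarrow> (\<Sum>i<p. (\<theta> ^^ (i + j)) \<alpha> * d i) = 0"
    by auto
  \<comment> \<open>A nonzero entry may have trace 0. Scaling entry \<open>i0\<close> to 1
    guarantees the nonzero trace p there.\<close>
  define e where "e i = d i * inverse (d i0)" for i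
  have e: "e i \<in> K" if "i < p" for i
    using that d(1,2) unfolding e_def by (intro mult_closed inverse_closed)
  have e_sum: "(\<Sum>i<p. (\<theta> ^^ (i + j)) \<alpha> * e i) = 0" if "j < p" for j
    using d(4) [OF that] unfolding e_def by (simp flip: mult.assoc sum_distrib_right)
  have conj_sum: "(\<Sum>i<p. (\<theta> ^^ k) (e i) * (\<theta> ^^ i) \<alpha>) = 0" if "k < p" for k
  proof -
    \<comment> \<open>Row \<open>j\<close> is chosen with k + j congruent to 0 modulo p, so that the
      k-th iterate of \<theta> turns its coefficients into those of row 0. The outer
      \<open>mod\<close> keeps \<open>j < p\<close> when \<open>k = 0\<close>.\<close>
    define j where "j = (p - k) mod p"
    have "(k + (i + j)) mod p = i mod p" for i
    proof -
      have "(k + (i + j)) mod p = (k + i + (p - k)) mod p"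
        unfolding j_def by (metis add.assoc mod_add_right_eq)
      also have "k + i + (p - k) = i + p"
        using that by simp
      finally show ?thesis by simp
    qed
    then have shift: "(\<theta> ^^ k) ((\<theta> ^^ (i + j)) \<alpha>) = (\<theta> ^^ i) \<alpha>" for i
      using pow_mod [OF \<alpha>, of "k + (i + j)"] pow_mod [OF \<alpha>, of i] by (simp add: funpow_add)
    have "0 = (\<theta> ^^ k) (\<Sum>i<p. (\<theta> ^^ (i + j)) \<alpha> * e i)"
      using e_sum [of j] p_pos by (simp add: j_def pow_zero)
    also have "\<dots> = (\<Sum>i<p. (\<theta> ^^ k) ((\<theta> ^^ (i + j)) \<alpha> * e i))"
      using \<alpha> e by (intro pow_sum mult_closed pow_closed) auto
    also have "\<dots> = (\<Sum>i<p. (\<theta> ^^ k) (e i) * (\<theta> ^^ i) \<alpha>)"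
      using \<alpha> e by (intro sum.cong refl) (subst pow_mult, auto simp: pow_closed shift)
    finally show ?thesis by simp
  qed
  define t where "t i = field_trace p \<theta> (e i)" for i
  have t: "(\<Sum>i<p. t i * (\<theta> ^^ i) \<alpha>) = 0"
  proof -
    have "(\<Sum>i<p. t i * (\<theta> ^^ i) \<alpha>) = (\<Sum>i<p. \<Sum>k<p. (\<theta> ^^ k) (e i) * (\<theta> ^^ i) \<alpha>)"
      by (simp add: t_def field_trace_def sum_distrib_right)
    also have "\<dots> = (\<Sum>k<p. \<Sum>i<p. (\<theta> ^^ k) (e i) * (\<theta> ^^ i) \<alpha>)"
      by (rule sum.swap)
    also have "\<dots> = 0"
      using conj_sum by simp
    finally show ?thesis .
  qed
  have "t i0 = real p"
    using d(3) by (simp add: t_def e_def field_trace_def pow_one)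
  obtain N :: int where N: "N \<noteq> 0" "\<forall>i\<in>{..<p}. of_int N * t i \<in> \<int>"
    using Rats_common_denominator [of "{..<p}" t] e trace_Rats unfolding t_def by auto
  \<comment> \<open>The floor only extracts the integer: \<open>of_int N * t i\<close> is already
    integral for \<open>i < p\<close>.\<close>
  define b where "b i = \<lfloor>of_int N * t i\<rfloor>" for i
  have b: "of_int (b i) = of_int N * t i" if "i < p" for i
    using N(2) that unfolding b_def by auto
  show ?thesis
  proof (rule that)
    have "b i0 \<noteq> 0"
      using b [OF d(2)] \<open>t i0 = real p\<close> N(1) p_pos by auto
    then show "\<exists>i<p. b i \<noteq> 0"
      using d(2) by blast
    have "(\<Sum>i<p. of_int (b i) * (\<theta> ^^ i) \<alpha>) = of_int N * (\<Sum>i<p. t i * (\<theta> ^^ i) \<alpha>)"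
      by (simp add: b sum_distrib_left mult.assoc)
    then show "(\<Sum>i<p. of_int (b i) * (\<theta> ^^ i) \<alpha>) = 0"
      using t by simp
  qed
qed

text \<open>Two equal conjugates make \<alpha> a fixed point of the iterate of order
  \<open>j - i\<close>. This number is coprime to p, so by Bezout \<theta> itself would fix
  \<alpha>.\<close>

lemma inj_on_conjugates:
  assumes \<alpha>: "\<alpha> \<in> K" "\<theta> \<alpha> \<noteq> \<alpha>"
  shows "inj_on (\<lambda>i. (\<theta> ^^ i) \<alpha>) {..<p}"
proof (rule linorder_inj_onI)
  fix i j
  assume ij: "i < j" "i \<in> {..<p}" "j \<in> {..<p}"
  show "(\<theta> ^^ i) \<alpha> \<noteq> (\<theta> ^^ j) \<alpha>"
  proof
    assume "(\<theta> ^^ i) \<alpha> = (\<theta> ^^ j) \<alpha>"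
    \<comment> \<open>Applying p - i further iterations closes the cycle on the left and leaves an
      excess of \<open>j - i\<close> on the right.\<close>
    then have "(\<theta> ^^ (p - i + i)) \<alpha> = (\<theta> ^^ (p - i + j)) \<alpha>"
      by (simp only: funpow_add o_apply)
    moreover have "p - i + i = p" "p - i + j = (j - i) + p"
      using ij by auto
    ultimately have "(\<theta> ^^ p) \<alpha> = (\<theta> ^^ (j - i + p)) \<alpha>"
      by metis
    then have fix_n: "(\<theta> ^^ (j - i)) \<alpha> = \<alpha>"
      using \<alpha>(1) by (simp only: funpow_add o_apply theta_pow_p)
    have "\<not> p dvd j - i"
      using ij by (auto dest: dvd_imp_le)
    then have "coprime (j - i) p"
      using prime_p by (simp add: prime_imp_coprime coprime_commute)
    then obtain x y where xy: "(j - i) * x = Suc (p * y)"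
      using bezout_nat [of "j - i" p] ij by auto
    have "\<theta> \<alpha> = \<theta> ((\<theta> ^^ (p * y)) \<alpha>)"
      using pow_mod [OF \<alpha>(1), of "p * y"] by simp
    also have "\<dots> = (\<theta> ^^ ((j - i) * x)) \<alpha>"
      by (simp add: xy)
    also have "\<dots> = \<alpha>"
      using funpow_mod_eq [OF fix_n, of "(j - i) * x"] by simp
    finally show False
      using \<alpha>(2) by simp
  qed
qed auto

end

section \<open>Galois groups\<close>

lemma carrier_Gal:
  "carrier (Gal K F) = {f \<in> Bij K. f \<in> Ring.ring_hom (real_field\<lparr>carrier := K\<rparr>) (real_field\<lparr>carrier := K\<rparr>) \<and>
     (\<forall>x\<in>F. f x = x)}"
  by (simp add: Gal_def)

text \<open>Supplies the group laws of \<open>Gal\<close>. Inverses are restricted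
  \<open>inv_into\<close> maps, which inherit additivity and multiplicativity from
  \<open>f\<close>.\<close>

lemma subgroup_carrier_Gal:
  assumes K: "subfield K real_field" and F: "F \<subseteq> K"
  shows "subgroup (carrier (Gal K F)) (BijGroup K)"
proof
  have "subring K real_field"
    using subfieldE(1) [OF K] .
  then have K_closed: "1 \<in> K" "\<And>x y. x \<in> K \<Longrightarrow> y \<in> K \<Longrightarrow> x + y \<in> K"
    "\<And>x y. x \<in> K \<Longrightarrow> y \<in> K \<Longrightarrow> x * y \<in> K"
    using subringE(3,6,7) by fastforce+
  show "carrier (Gal K F) \<subseteq> carrier (BijGroup K)"
    by (auto simp: carrier_Gal BijGroup_def)
  show "\<one>\<^bsub>BijGroup K\<^esub> \<in> carrier (Gal K F)"
    using F K_closed by (auto simp: carrier_Gal BijGroup_def id_Bij Ring.ring_hom_def)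
  fix f
  assume f: "f \<in> carrier (Gal K F)"
  then have f_Bij: "f \<in> Bij K"
    by (simp add: carrier_Gal)
  show "f \<otimes>\<^bsub>BijGroup K\<^esub> g \<in> carrier (Gal K F)" if g: "g \<in> carrier (Gal K F)" for g
    using f g F K_closed compose_Bij [of f K g]
    by (auto simp: carrier_Gal BijGroup_def compose_Bij Ring.ring_hom_def compose_def Pi_iff subset_iff)
  have inv_fixed: "inv_into K f x = x" if "x \<in> F" for x
    using that f F by (intro inv_into_f_eq) (auto simp: carrier_Gal Bij_def bij_betw_def)
  have "inv_into K f 1 = 1"
    using f K_closed(1) by (intro inv_into_f_eq) (auto simp: carrier_Gal Bij_def bij_betw_def Ring.ring_hom_def)
  moreover have "inv_into K f (x + y) = inv_into K f x + inv_into K f y" if "x \<in> K" "y \<in> K" for x y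
    using f K_closed that by (intro Bij_inv_into_lemma [of K f "(+)"]) (auto simp: carrier_Gal Ring.ring_hom_def)
  moreover have "inv_into K f (x * y) = inv_into K f x * inv_into K f y" if "x \<in> K" "y \<in> K" for x y
    using f K_closed that by (intro Bij_inv_into_lemma [of K f "(*)"]) (auto simp: carrier_Gal Ring.ring_hom_def)
  ultimately show "inv\<^bsub>BijGroup K\<^esub> f \<in> carrier (Gal K F)"
    using F K_closed inv_fixed restrict_inv_into_Bij [OF f_Bij] Bij_inv_into_mem [OF f_Bij]
    by (auto simp: inv_BijGroup [OF f_Bij] carrier_Gal Ring.ring_hom_def)
qed

lemma group_Gal:
  assumes "subfield K real_field" "F \<subseteq> K"
  shows "group (Gal K F)"
proof -
  have "Gal K F = BijGroup K\<lparr>carrier := carrier (Gal K F)\<rparr>"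
    by (simp add: Gal_def)
  then show ?thesis
    using group.subgroup_imp_group [OF group_BijGroup subgroup_carrier_Gal [OF assms]] by simp
qed

lemma mult_Gal:
  assumes "f \<in> carrier (Gal K F)" "g \<in> carrier (Gal K F)" "x \<in> K"
  shows "(f \<otimes>\<^bsub>Gal K F\<^esub> g) x = f (g x)"
  using assms by (simp add: Gal_def BijGroup_def compose_def)

lemma one_Gal: "x \<in> K \<Longrightarrow> \<one>\<^bsub>Gal K F\<^esub> x = x"
  by (simp add: Gal_def BijGroup_def)

lemma Gal_closed: "f \<in> carrier (Gal K F) \<Longrightarrow> x \<in> K \<Longrightarrow> f x \<in> K"
  by (auto simp: carrier_Gal Ring.ring_hom_def)

text \<open>Group powers are extensional compositions, so they agree with plain iteration at points
  of \<open>K\<close>.\<close>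

lemma pow_Gal:
  assumes "group (Gal K F)" "f \<in> carrier (Gal K F)" "x \<in> K"
  shows "(f [^]\<^bsub>Gal K F\<^esub> (n :: nat)) x = (f ^^ n) x"
  using assms(3)
proof (induction n arbitrary: x)
  case 0
  then show ?case
    by (simp add: one_Gal)
next
  case (Suc n)
  interpret group "Gal K F" by fact
  show ?case
    using Suc assms(2) by (simp add: mult_Gal Gal_closed funpow_swap1)
qed

text \<open>The p-th power of \<theta> is trivial by the group order. A point fixed by \<theta> is
  fixed by everything \<theta> generates, hence rational by the Galois condition.\<close>

lemma cyclic_automorphismI:
  assumes p: "prime p" and K: "cyclic_number_field p K"
    and \<theta>: "\<theta> \<in> carrier (Gal K \<rat>)" "generate (Gal K \<rat>) {\<theta>} = carrier (Gal K \<rat>)"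
  shows "cyclic_automorphism p K \<theta>"
proof -
  have subfield: "subfield K real_field" and order: "Coset.order (Gal K \<rat>) = p"
    and Rats: "{x \<in> K. \<forall>f\<in>carrier (Gal K \<rat>). f x = x} = \<rat>"
    using K by (auto simp: cyclic_number_field_def number_field_of_degree_def galois_over_rat_def)
  from Rats have "\<rat> \<subseteq> K"
    by blast
  then interpret G: group "Gal K \<rat>"
    by (rule group_Gal [OF subfield])
  have "subring K real_field"
    using subfieldE(1) [OF subfield] .
  then have K_closed: "1 \<in> K" "\<And>x. x \<in> K \<Longrightarrow> - x \<in> K"
    "\<And>x y. x \<in> K \<Longrightarrow> y \<in> K \<Longrightarrow> x + y \<in> K" "\<And>x y. x \<in> K \<Longrightarrow> y \<in> K \<Longrightarrow> x * y \<in> K"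
    using subringE(3,5,6,7) [of K real_field] by (auto simp: class_ring_simps)
  show ?thesis
  proof
    show "x - y \<in> K" if "x \<in> K" "y \<in> K" for x y
      using K_closed(3) [OF that(1) K_closed(2) [OF that(2)]] by simp
    show "inverse x \<in> K" if "x \<in> K" for x
    \<comment> \<open>Zero is covered by the convention \<open>inverse 0 = 0\<close>; otherwise
      uniqueness identifies the ring inverse with the real one.\<close>
    proof (cases "x = 0")
      case False
      have "inv\<^bsub>real_field\<^esub> x \<in> K" "x * inv\<^bsub>real_field\<^esub> x = 1"
        using ring.subfield_m_inv(1,2) [OF class_ring.ring_axioms subfield, of x] that False by auto
      then show ?thesis
        by (metis inverse_unique)
    qed (use that in simp)
    show "(\<theta> ^^ p) x = x" if "x \<in> K" for x
      using G.pow_order_eq_1 [OF \<theta>(1)] that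
      by (simp add: order one_Gal flip: pow_Gal [OF G.group_axioms \<theta>(1)])
    show "x \<in> \<rat>" if x: "x \<in> K" "\<theta> x = x" for x
    proof -
      \<comment> \<open>Membership in the carrier is carried through the induction because
        evaluating a group product by \<open>mult_Gal\<close> requires it.\<close>
      have "f \<in> carrier (Gal K \<rat>) \<and> f x = x" if "f \<in> generate (Gal K \<rat>) {\<theta>}" for f
        using that
      proof (induction rule: generate.induct)
        case (inv h)
        then have "(inv\<^bsub>Gal K \<rat>\<^esub> \<theta>) (\<theta> x) = x"
          using x(1) \<theta>(1) mult_Gal [of "inv\<^bsub>Gal K \<rat>\<^esub> \<theta>" K \<rat> \<theta> x] by (simp add: one_Gal)
        with inv x(2) \<theta>(1) show ?case
          by simp
      qed (use x \<theta>(1) in \<open>auto simp: one_Gal mult_Gal\<close>)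
      then show ?thesis
        using x(1) Rats \<theta>(2) by blast
    qed
  qed (use p K_closed \<theta>(1) in \<open>auto simp: carrier_Gal Ring.ring_hom_def\<close>)
qed

section \<open>Linear independence of conjugate vectors\<close>

text \<open>Linear dependence concerns a set, with coefficients attached to vectors; injectivity of
  \<open>v\<close> lets them be attached to indices instead.\<close>

lemma lin_dep_image_iff:
  fixes v :: "nat \<Rightarrow> 'a :: field vec"
  assumes v: "\<And>i. i < m \<Longrightarrow> v i \<in> carrier_vec n" and inj: "inj_on v {..<m}"
  shows "module.lin_dep class_ring (module_vec TYPE('a) n) (v ` {..<m}) \<longleftrightarrow>
    (\<exists>c. (\<exists>i<m. c i \<noteq> 0) \<and> (\<forall>j<n. (\<Sum>i<m. c i * v i $ j) = 0))"
    (is "?dep \<longleftrightarrow> ?rel")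
proof -
  interpret vec_space "TYPE('a)" n .
  have carrier: "v ` {..<m} \<subseteq> carrier_vec n"
    using v by auto
  have index: "lincomb a (v ` {..<m}) $ j = (\<Sum>i<m. a (v i) * v i $ j)" if "j < n" for a j
    by (simp add: lincomb_index [OF that carrier] sum.reindex [OF inj])
  show ?thesis
  proof
    assume ?dep
    then obtain a w where a: "lincomb a (v ` {..<m}) = 0\<^sub>v n" "w \<in> v ` {..<m}" "a w \<noteq> 0"
      using finite_lin_dep [of "v ` {..<m}"] carrier by auto
    show ?rel
    proof (intro exI [of _ "\<lambda>i. a (v i)"] conjI allI impI)
      show "\<exists>i<m. a (v i) \<noteq> 0"
        using a by auto
      show "(\<Sum>i<m. a (v i) * v i $ j) = 0" if "j < n" for j
        using index [OF that, of a] a(1) that by simp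
    qed
  next
    assume ?rel
    then obtain c i where c: "i < m" "c i \<noteq> 0" "\<And>j. j < n \<Longrightarrow> (\<Sum>i<m. c i * v i $ j) = 0"
      by blast
    define a where "a = c \<circ> the_inv_into {..<m} v"
    have a: "a (v i) = c i" if "i < m" for i
      using that inj by (simp add: a_def the_inv_into_f_f)
    have "lincomb a (v ` {..<m}) \<in> carrier_vec n"
      using carrier by (intro lincomb_closed) auto
    then have "lincomb a (v ` {..<m}) = 0\<^sub>v n"
      using c(3) by (intro eq_vecI) (auto simp: index a)
    then show ?dep
      using c(1,2) a by (intro lin_dep_crit [where A = "v ` {..<m}" and a = a and v = "v i"]) auto
  qed
qed

theorem proposition3p2:
  fixes p :: nat and K :: "real set" and \<theta> :: "real \<Rightarrow> real" and \<alpha> :: real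
  assumes "prime p" and "p > 2"
    and "cyclic_number_field p K"
    and "\<theta> \<in> carrier (Gal K \<rat>)"
    and "generate (Gal K \<rat>) {\<theta>} = carrier (Gal K \<rat>)"
    and "\<alpha> \<in> ring_of_integers K - \<int>"
  shows "field_trace p \<theta> \<alpha> \<noteq> 0 \<longleftrightarrow>
    module.lin_indpt real_field (module_vec TYPE(real) p)
      {canonical_embedding p \<theta> ((\<theta> ^^ i) \<alpha>) | i. i < p}"
proof -
  interpret cyclic_automorphism p K \<theta>
    using assms by (intro cyclic_automorphismI)
  \<comment> \<open>A rational algebraic integer is an integer, so \<alpha> is irrational and cannot
    be fixed by \<theta>.\<close>
  have \<alpha>: "\<alpha> \<in> K" "\<theta> \<alpha> \<noteq> \<alpha>"
    using assms(6) theta_fixed rational_algebraic_int_is_int by (auto simp: ring_of_integers_def)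
  define v where "v i = canonical_embedding p \<theta> ((\<theta> ^^ i) \<alpha>)" for i
  have index: "v i $ j = (\<theta> ^^ (i + j)) \<alpha>" if "j < p" for i j
    using that by (simp add: v_def canonical_embedding_def funpow_add add.commute [of i])
  have "inj_on v {..<p}"
  proof (rule inj_onI)
    fix i j
    assume "i \<in> {..<p}" "j \<in> {..<p}" "v i = v j"
    then show "i = j"
      \<comment> \<open>Coordinate 0 of \<open>v i\<close> is the i-th conjugate of \<alpha>, which
        already determines i.\<close>
      using index [OF p_pos, of i] index [OF p_pos, of j] inj_on_conjugates [OF \<alpha>]
      by (auto dest: inj_onD)
  qed
  moreover have "v i \<in> carrier_vec p" for i
    by (simp add: v_def canonical_embedding_def)
  ultimately have dep_iff: "module.lin_dep real_field (module_vec TYPE(real) p) (v ` {..<p}) \<longleftrightarrow>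
      (\<exists>c. (\<exists>i<p. c i \<noteq> 0) \<and> (\<forall>j<p. (\<Sum>i<p. c i * (\<theta> ^^ (i + j)) \<alpha>) = 0))"
    by (subst lin_dep_image_iff) (auto simp: index)
  have "field_trace p \<theta> \<alpha> = 0 \<longleftrightarrow>
      (\<exists>c. (\<exists>i<p. c i \<noteq> 0) \<and> (\<forall>j<p. (\<Sum>i<p. c i * (\<theta> ^^ (i + j)) \<alpha>) = 0))"
  proof
    assume trace: "field_trace p \<theta> \<alpha> = 0"
    \<comment> \<open>With all coefficients 1, coordinate \<open>j\<close> of the sum of the vectors
      is the j-th conjugate of the trace.\<close>
    have "(\<Sum>i<p. 1 * (\<theta> ^^ (i + j)) \<alpha>) = 0" for j
    proof -
      have "(\<Sum>i<p. 1 * (\<theta> ^^ (i + j)) \<alpha>) = (\<Sum>i<p. (\<theta> ^^ j) ((\<theta> ^^ i) \<alpha>))"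
        by (simp add: funpow_add add.commute [of _ j])
      also have "\<dots> = (\<theta> ^^ j) (field_trace p \<theta> \<alpha>)"
        unfolding field_trace_def using \<alpha>(1) by (intro pow_sum [symmetric] pow_closed)
      finally show ?thesis
        by (simp add: trace pow_zero)
    qed
    then show "\<exists>c. (\<exists>i<p. c i \<noteq> 0) \<and> (\<forall>j<p. (\<Sum>i<p. c i * (\<theta> ^^ (i + j)) \<alpha>) = 0)"
      using p_pos by (intro exI [of _ "\<lambda>_. 1"]) auto
  next
    assume "\<exists>c. (\<exists>i<p. c i \<noteq> 0) \<and> (\<forall>j<p. (\<Sum>i<p. c i * (\<theta> ^^ (i + j)) \<alpha>) = 0)"
    then obtain c where "\<exists>i<p. c i \<noteq> 0" "\<And>j. j < p \<Longrightarrow> (\<Sum>i<p. c i * (\<theta> ^^ (i + j)) \<alpha>) = 0"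
      by blast
    then obtain b :: "nat \<Rightarrow> int" where "\<exists>i<p. b i \<noteq> 0" "(\<Sum>i<p. of_int (b i) * (\<theta> ^^ i) \<alpha>) = 0"
      by (rule int_relation_of_real_relation [OF \<alpha>(1)])
    then show "field_trace p \<theta> \<alpha> = 0"
      by (rule trace_eq_0_of_int_relation [OF \<alpha>])
  qed
  moreover have "{canonical_embedding p \<theta> ((\<theta> ^^ i) \<alpha>) | i. i < p} = v ` {..<p}"
    by (auto simp: v_def)
  ultimately show ?thesis
    using dep_iff by simp
qed

end
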